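(* Let $A$ be a just infinite associative algebra over a field $k$ with $\operatorname{char}(A)\neq 2$. Then $A^+$ is also a just infinite algebra over $k$ (as a Jordan algebra).
   Context: An associative $k$-algebra $A$ is called just infinite (dimensional) if $\dim_k A=\infty$ and $\dim_k A/I<\infty$ for every nonzero two-sided ideal $I$ of $A$. For an associative algebra $A$, $A^+$ denotes the Jordan algebra on the underlying space of $A$ with product $a\ast b=ab+ba$. A Jordan ideal of $A$ is an ideal of $A^+$. That $A^+$ is just infinite means: $\dim_k A^+=\infty$ and $\dim_k A^+/I<\infty$ for every nonzero ideal $I$ of the Jordan algebra $A^+$. *)

theory Defs
  imports HOL.Vector_Spaces "HOL-Library.Set_Algebras"
begin

text \<open>
  A vector space with carrier \<open>V\<close>, zero \<open>z\<close>, addition \<open>add\<close> and scalar multiplication \<open>smul\<close>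
  is finite-dimensional if it is spanned by finitely many vectors. The operations are explicit
  because the notion is needed both for a whole type and for a quotient space, whose vectors are
  cosets.
\<close>

definition finite_dim ::
  "'v set \<Rightarrow> 'v \<Rightarrow> ('v \<Rightarrow> 'v \<Rightarrow> 'v) \<Rightarrow> ('k \<Rightarrow> 'v \<Rightarrow> 'v) \<Rightarrow> bool" where
  "finite_dim V z add smul \<longleftrightarrow>
     (\<exists>vs. set vs \<subseteq> V \<and>
       (\<forall>v\<in>V. \<exists>cs. length cs = length vs \<and> v = foldr add (map2 smul cs vs) z))"

context vector_space
begin

definition quotient_space :: "'b set \<Rightarrow> 'b set set" where
  "quotient_space I = range (\<lambda>a. a +o I)"

text \<open>
  Cosets are added by the elementwise sum of sets. The summand \<open>I\<close> below matters only for
  \<open>c = 0\<close>, where the image alone is \<open>{0}\<close> instead of the zero coset \<open>I\<close>.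
\<close>

definition coset_scale :: "'b set \<Rightarrow> 'a \<Rightarrow> 'b set \<Rightarrow> 'b set" where
  "coset_scale I c X = scale c ` X + I"

definition finite_dim_quotient :: "'b set \<Rightarrow> bool" where
  "finite_dim_quotient I \<longleftrightarrow> finite_dim (quotient_space I) I (+) (coset_scale I)"

lemma coset_add_eq:
  assumes "subspace I"
  shows "(a +o I) + (b +o I) = (a + b) +o I"
proof -
  have "I + I = I"
  proof
    show "I + I \<subseteq> I"
      using assms by (auto simp: set_plus_def subspace_add)
    show "I \<subseteq> I + I"
      using subspace_0[OF assms] by (force simp: set_plus_def)
  qed
  then show ?thesis
    by (simp add: set_plus_rearrange)
qed

lemma coset_scale_eq:
  assumes "subspace I"
  shows "coset_scale I c (a +o I) = (c *s a) +o I"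
proof
  show "coset_scale I c (a +o I) \<subseteq> (c *s a) +o I"
    using assms
    by (auto simp: coset_scale_def set_plus_def elt_set_plus_def scale_right_distrib add.assoc
        intro!: subspace_add subspace_scale)
  show "(c *s a) +o I \<subseteq> coset_scale I c (a +o I)"
    using subspace_0[OF assms]
    by (force simp: coset_scale_def set_plus_def elt_set_plus_def)
qed

lemma finite_dim_UNIV_iff:
  "finite_dim UNIV 0 (+) scale \<longleftrightarrow> (\<exists>B. finite B \<and> span B = UNIV)"
proof
  assume "finite_dim UNIV 0 (+) scale"
  then obtain vs where vs: "\<And>v. \<exists>cs. length cs = length vs \<and> v = foldr (+) (map2 scale cs vs) 0"
    unfolding finite_dim_def by auto
  have "foldr (+) (map2 scale cs ws) 0 \<in> span (set vs)" if "set ws \<subseteq> set vs" for cs ws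
    using that
  proof (induction ws arbitrary: cs)
    case (Cons w ws)
    then show ?case
      by (cases cs) (auto intro!: span_add span_scale intro: span_base span_zero)
  qed (simp add: span_zero)
  then have "span (set vs) = UNIV"
    using vs by (metis UNIV_eq_I order_refl)
  then show "\<exists>B. finite B \<and> span B = UNIV"
    by blast
next
  assume "\<exists>B. finite B \<and> span B = UNIV"
  then obtain B where B: "finite B" "span B = UNIV"
    by blast
  obtain vs where vs: "set vs = B" "distinct vs"
    using B(1) finite_distinct_list by blast
  have sum: "foldr (+) (map2 scale (map u ws) ws) 0 = (\<Sum>w\<in>set ws. u w *s w)"
    if "distinct ws" for ws u
    using that by (induction ws) auto
  have "\<exists>cs. length cs = length vs \<and> v = foldr (+) (map2 scale cs vs) 0" for v
  proof -
    have "v \<in> span B"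
      using B by simp
    then obtain u where "v = (\<Sum>w\<in>B. u w *s w)"
      using span_finite[OF B(1)] by auto
    then have "v = foldr (+) (map2 scale (map u vs) vs) 0"
      using sum[OF vs(2)] vs(1) by simp
    then show ?thesis
      by (intro exI[of _ "map u vs"]) simp
  qed
  then show "finite_dim UNIV 0 (+) scale"
    unfolding finite_dim_def by auto
qed

lemma finite_dim_quotient_iff:
  assumes I: "subspace I"
  shows "finite_dim_quotient I \<longleftrightarrow> (\<exists>B. finite B \<and> span (B \<union> I) = UNIV)"
proof -
  have comb: "foldr (+) (map2 (coset_scale I) cs (map (\<lambda>a. a +o I) as)) I =
      foldr (+) (map2 scale cs as) 0 +o I" for cs as
  proof (induction as arbitrary: cs)
    case (Cons a as)
    then show ?case
      by (cases cs) (simp_all add: coset_add_eq[OF I] coset_scale_eq[OF I])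
  qed simp
  have coset_eq: "a +o I = b +o I \<longleftrightarrow> a - b \<in> I" for a b
  proof
    assume "a +o I = b +o I"
    moreover have "a \<in> a +o I"
      using subspace_0[OF I] by (force simp: elt_set_plus_def)
    ultimately show "a - b \<in> I"
      by (auto simp: elt_set_plus_def)
  next
    assume d: "a - b \<in> I"
    have "a + x = b + ((a - b) + x)" "b + x = a + (x - (a - b))" for x
      by simp_all
    with d show "a +o I = b +o I"
      unfolding elt_set_plus_def
      by (blast intro: subspace_add[OF I] subspace_diff[OF I])
  qed
  show ?thesis
  proof
    assume "finite_dim_quotient I"
    then obtain Xs where Xs: "set Xs \<subseteq> quotient_space I"
      and comb_Xs: "\<And>X. X \<in> quotient_space I \<Longrightarrow>
        \<exists>cs. length cs = length Xs \<and> X = foldr (+) (map2 (coset_scale I) cs Xs) I"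
      unfolding finite_dim_quotient_def finite_dim_def by blast
    obtain as where as: "Xs = map (\<lambda>a. a +o I) as"
      using Xs unfolding quotient_space_def by (metis ex_map_conv subsetD rangeE)
    have sp: "foldr (+) (map2 scale cs ws) 0 \<in> span (set as)" if "set ws \<subseteq> set as" for cs ws
      using that
    proof (induction ws arbitrary: cs)
      case (Cons w ws)
      then show ?case
        by (cases cs) (auto intro!: span_add span_scale intro: span_base span_zero)
    qed (simp add: span_zero)
    have "v \<in> span (set as \<union> I)" for v
    proof -
      obtain cs where "v +o I = foldr (+) (map2 scale cs as) 0 +o I"
        using comb_Xs[of "v +o I"] comb as unfolding quotient_space_def by auto
      then have "v - foldr (+) (map2 scale cs as) 0 \<in> span (set as \<union> I)"
        unfolding coset_eq by (simp add: span_base)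
      moreover have "foldr (+) (map2 scale cs as) 0 \<in> span (set as \<union> I)"
        using sp[of as] span_mono[of "set as" "set as \<union> I"] by blast
      ultimately show ?thesis
        using span_add by (metis diff_add_cancel)
    qed
    then show "\<exists>B. finite B \<and> span (B \<union> I) = UNIV"
      by blast
  next
    assume "\<exists>B. finite B \<and> span (B \<union> I) = UNIV"
    then obtain B where B: "finite B" "span (B \<union> I) = UNIV"
      by blast
    obtain vs where vs: "set vs = B" "distinct vs"
      using B(1) finite_distinct_list by blast
    have sum: "foldr (+) (map2 scale (map u ws) ws) 0 = (\<Sum>w\<in>set ws. u w *s w)"
      if "distinct ws" for ws u
      using that by (induction ws) auto
    have "\<exists>cs. length cs = length vs \<and>
        v +o I = foldr (+) (map2 (coset_scale I) cs (map (\<lambda>a. a +o I) vs)) I" for v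
    proof -
      have "v \<in> span (B \<union> I)"
        using B by simp
      then obtain x y where v: "v = x + y" "x \<in> span B" "y \<in> I"
        using I by (auto simp: span_Un span_eq_iff[THEN iffD2])
      then obtain u where "x = (\<Sum>w\<in>B. u w *s w)"
        using span_finite[OF B(1)] by auto
      then have "x = foldr (+) (map2 scale (map u vs) vs) 0"
        using sum[OF vs(2)] vs(1) by simp
      moreover have "v +o I = x +o I"
        using v coset_eq by simp
      ultimately show ?thesis
        by (intro exI[of _ "map u vs"]) (simp add: comb)
    qed
    then show "finite_dim_quotient I"
      unfolding finite_dim_quotient_def finite_dim_def quotient_space_def
      by (intro exI[of _ "map (\<lambda>a. a +o I) vs"]) auto
  qed
qed

end

text \<open>Algebras here need not be associative, commutative or unital.\<close>

locale algebra_over = vector_space scale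
  for scale :: "'k::field \<Rightarrow> 'a::ab_group_add \<Rightarrow> 'a" (infixr \<open>*s\<close> 75) +
  fixes prod :: "'a \<Rightarrow> 'a \<Rightarrow> 'a" (infixl \<open>\<odot>\<close> 70)
  assumes prod_add_left: "(x + y) \<odot> z = x \<odot> z + y \<odot> z"
    and prod_add_right: "x \<odot> (y + z) = x \<odot> y + x \<odot> z"
    and prod_scale_left: "(c *s x) \<odot> y = c *s (x \<odot> y)"
    and prod_scale_right: "x \<odot> (c *s y) = c *s (x \<odot> y)"
begin

definition two_sided_ideal :: "'a set \<Rightarrow> bool" where
  "two_sided_ideal I \<longleftrightarrow> subspace I \<and> (\<forall>a. \<forall>x\<in>I. a \<odot> x \<in> I \<and> x \<odot> a \<in> I)"

end

locale just_infinite_algebra = algebra_over +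
  assumes infinite_dim: "\<not> finite_dim UNIV 0 (+) scale"
    and finite_dim_quotients:
      "\<And>I. two_sided_ideal I \<Longrightarrow> I \<noteq> {0} \<Longrightarrow> finite_dim_quotient I"

text \<open>Associativity of the product is part of the class \<^class>\<open>ring\<close>, which does not require a unit.\<close>

locale assoc_algebra = algebra_over scale "(*)"
  for scale :: "'k::field \<Rightarrow> 'a::ring \<Rightarrow> 'a"

locale jordan_algebra = algebra_over +
  assumes prod_commute: "x \<odot> y = y \<odot> x"
    and jordan_identity: "(x \<odot> y) \<odot> (x \<odot> x) = x \<odot> (y \<odot> (x \<odot> x))"

definition jordan_prod :: "'a::ring \<Rightarrow> 'a \<Rightarrow> 'a" where
  "jordan_prod a b = a * b + b * a"

sublocale assoc_algebra \<subseteq> plus: jordan_algebra scale jordan_prod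
proof
  fix x y z :: 'a and c :: 'k
  show "jordan_prod (x + y) z = jordan_prod x z + jordan_prod y z"
    by (simp add: jordan_prod_def algebra_simps)
  show "jordan_prod x (y + z) = jordan_prod x y + jordan_prod x z"
    by (simp add: jordan_prod_def algebra_simps)
  show "jordan_prod (scale c x) y = scale c (jordan_prod x y)"
    by (simp add: jordan_prod_def prod_scale_left prod_scale_right scale_right_distrib)
  show "jordan_prod x (scale c y) = scale c (jordan_prod x y)"
    by (simp add: jordan_prod_def prod_scale_left prod_scale_right scale_right_distrib)
  show "jordan_prod x y = jordan_prod y x"
    by (simp add: jordan_prod_def add.commute)
  show "jordan_prod (jordan_prod x y) (jordan_prod x x) =
      jordan_prod x (jordan_prod y (jordan_prod x x))"
    by (simp add: jordan_prod_def algebra_simps)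
qed

end

theory Submission
  imports Defs
begin

text \<open>
  A nonzero Jordan ideal \<open>J\<close> must be shown to have finite codimension. Over a field with
  \<open>2 \<noteq> 0\<close>, every Jordan product \<open>a b + b a\<close> of two elements of \<open>J\<close> generates an associative
  ideal that lies inside \<open>J\<close> (Herstein's argument, \<open>jordan_prod_ideal_gen_subset\<close>). If one of these
  products is nonzero, then \<open>J\<close> contains a nonzero associative ideal, which has finite codimension
  because \<open>A\<close> is just infinite, and so \<open>J\<close> has finite codimension too.

  Otherwise all Jordan products in \<open>J\<close> vanish, and then each \<open>c \<in> J\<close> satisfies \<open>c c = 0\<close> and
  \<open>c A c = 0\<close>; its ideal \<open>I\<close> is annihilated by \<open>c\<close> on both sides. A just infinite algebra has no
  such \<open>c \<noteq> 0\<close> (\<open>just_infinite_no_square_zero_sandwich\<close>): \<open>I\<close> has finite codimension, so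
  \<open>A = F + I\<close> with \<open>F\<close> finite-dimensional, and \<open>I = k c + F c + c F + F c F\<close> is
  finite-dimensional. Then \<open>A\<close> itself would be finite-dimensional.
\<close>

section \<open>Division by two and subspaces of finite codimension\<close>

lemma two_neq_0_if_CHAR_neq_2:
  assumes "CHAR('k::field) \<noteq> 2"
  shows "(2::'k) \<noteq> 0"
proof
  assume "(2::'k) = 0"
  then have "of_nat 2 = (0::'k)"
    by simp
  then have "CHAR('k) dvd 2"
    by (simp only: of_nat_eq_0_iff_char_dvd)
  moreover from this have "CHAR('k) \<le> 2" "CHAR('k) \<noteq> 0"
    by (auto dest: dvd_imp_le intro!: gr0I)
  moreover have "CHAR('k) \<noteq> 1"
    by simp
  ultimately show False
    using assms by linarith
qed

lemma (in vector_space) double_in_subspace_iff: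
  assumes "subspace W" "(2::'a) \<noteq> 0"
  shows "x + x \<in> W \<longleftrightarrow> x \<in> W"
proof
  assume "x + x \<in> W"
  moreover have "x + x = scale 2 x"
    using scale_left_distrib[of 1 1 x] by simp
  ultimately have "scale (inverse 2) (scale 2 x) \<in> W"
    using subspace_scale[OF assms(1)] by metis
  then show "x \<in> W"
    using assms(2) by simp
qed (simp add: assms subspace_add)

lemma (in vector_space) finite_dim_quotient_mono:
  assumes "subspace I" "subspace J" "I \<subseteq> J" "finite_dim_quotient I"
  shows "finite_dim_quotient J"
proof -
  obtain B where "finite B" "span (B \<union> I) = UNIV"
    using assms by (auto simp: finite_dim_quotient_iff)
  moreover have "span (B \<union> I) \<subseteq> span (B \<union> J)"
    using assms(3) by (intro span_mono) auto
  ultimately show ?thesis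
    using assms(2) by (auto simp: finite_dim_quotient_iff)
qed

lemma (in algebra_over) prod_zero_left [simp]: "0 \<odot> x = 0"
  using prod_add_left[of 0 0 x] by simp

lemma (in algebra_over) prod_zero_right [simp]: "x \<odot> 0 = 0"
  using prod_add_right[of x 0 0] by simp

lemma (in algebra_over) prod_span_left:
  assumes "u \<in> span S" "subspace W" "\<And>s. s \<in> S \<Longrightarrow> s \<odot> v \<in> W"
  shows "u \<odot> v \<in> W"
  using assms(1)
  by (induction rule: span_induct_alt)
    (use assms in \<open>auto simp: prod_add_left prod_scale_left subspace_0 subspace_add subspace_scale\<close>)

lemma (in algebra_over) prod_span_right:
  assumes "v \<in> span T" "subspace W" "\<And>t. t \<in> T \<Longrightarrow> u \<odot> t \<in> W"
  shows "u \<odot> v \<in> W"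
  using assms(1)
  by (induction rule: span_induct_alt)
    (use assms in \<open>auto simp: prod_add_right prod_scale_right subspace_0 subspace_add subspace_scale\<close>)

section \<open>Ideals generated by one element\<close>

context assoc_algebra
begin

text \<open>
  The ring need not have a unit, so \<open>c\<close> and its one-sided multiples are listed apart from the
  products \<open>x c y\<close>. Finite sets \<open>F\<close> give the spanning sets in the finite-dimensionality argument.
\<close>

definition multiples :: "'a set \<Rightarrow> 'a \<Rightarrow> 'a set" where
  "multiples F c = {c} \<union> {x * c |x. x \<in> F} \<union> {c * y |y. y \<in> F} \<union> {x * c * y |x y. x \<in> F \<and> y \<in> F}"

definition ideal_gen :: "'a \<Rightarrow> 'a set" where
  "ideal_gen c = span (multiples UNIV c)"

lemma finite_multiples:
  assumes "finite F"
  shows "finite (multiples F c)"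
proof -
  have "{x * c * y |x y. x \<in> F \<and> y \<in> F} = (\<lambda>(x, y). x * c * y) ` (F \<times> F)"
    by auto
  then show ?thesis
    using assms by (simp add: multiples_def)
qed

lemma mem_ideal_gen: "c \<in> ideal_gen c"
  by (auto simp: ideal_gen_def multiples_def intro: span_base)

lemma two_sided_ideal_ideal_gen: "two_sided_ideal (ideal_gen c)"
proof -
  have "a * g \<in> multiples UNIV c" "g * a \<in> multiples UNIV c" if "g \<in> multiples UNIV c" for a g
    using that unfolding multiples_def by (auto; metis mult.assoc)+
  then have "a * v \<in> ideal_gen c" "v * a \<in> ideal_gen c" if "v \<in> ideal_gen c" for a v
    using prod_span_right[OF that[unfolded ideal_gen_def] subspace_span]
      prod_span_left[OF that[unfolded ideal_gen_def] subspace_span] span_base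
    unfolding ideal_gen_def by metis+
  then show ?thesis
    unfolding two_sided_ideal_def by (simp add: ideal_gen_def)
qed

section \<open>Associative ideals inside Jordan ideals\<close>

text \<open>
  Write \<open>u \<circ> v\<close> for the Jordan product. For \<open>a, b \<in> J\<close> and any \<open>x\<close>, the commutator of the Jordan product \<open>a \<circ> b\<close> with \<open>x\<close> is
  \<open>a \<circ> [b, x] + b \<circ> [a, x]\<close>, hence in \<open>J\<close>; so is \<open>(a \<circ> b) \<circ> x\<close>. Their sum and
  difference are twice the one-sided products of \<open>a \<circ> b\<close> with \<open>x\<close>.
\<close>

lemma jordan_ideal_mult_jordan_prod:
  assumes J: "plus.two_sided_ideal J" and two: "(2::'k) \<noteq> 0" and "a \<in> J" "b \<in> J"
  shows "jordan_prod a b * x \<in> J" "x * jordan_prod a b \<in> J"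
proof -
  have sub: "subspace J"
    and absorb: "\<And>u v. u \<in> J \<Longrightarrow> jordan_prod u v \<in> J"
    using J by (auto simp: plus.two_sided_ideal_def)
  define p where "p = jordan_prod a b"
  have p: "jordan_prod p x \<in> J"
    using assms absorb by (simp add: p_def)
  have "jordan_prod a (b * x - x * b) + jordan_prod b (a * x - x * a) = p * x - x * p"
    by (simp add: p_def jordan_prod_def algebra_simps)
  then have commutator: "p * x - x * p \<in> J"
    using assms absorb subspace_add[OF sub] by metis
  have "p * x + p * x = jordan_prod p x + (p * x - x * p)"
    "x * p + x * p = jordan_prod p x - (p * x - x * p)"
    by (simp_all add: jordan_prod_def)
  then have "p * x + p * x \<in> J" "x * p + x * p \<in> J"
    using subspace_add[OF sub p commutator] subspace_diff[OF sub p commutator] by metis+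
  then show "p * x \<in> J" "x * p \<in> J"
    unfolding p_def[symmetric] by (simp_all add: double_in_subspace_iff[OF sub two])
qed

text \<open>
  With \<open>p = a \<circ> b\<close>, the one-sided products \<open>p y\<close> and \<open>p (y x)\<close> lie in \<open>J\<close>, and so does
  \<open>x p y = (p y) \<circ> x - p (y x)\<close>.
\<close>

lemma jordan_prod_ideal_gen_subset:
  assumes J: "plus.two_sided_ideal J" and two: "(2::'k) \<noteq> 0" and ab: "a \<in> J" "b \<in> J"
  shows "ideal_gen (jordan_prod a b) \<subseteq> J"
proof -
  have sub: "subspace J"
    and absorb: "\<And>u v. u \<in> J \<Longrightarrow> jordan_prod u v \<in> J"
    using J by (auto simp: plus.two_sided_ideal_def)
  define p where "p = jordan_prod a b"
  note one_sided = jordan_ideal_mult_jordan_prod[OF J two ab, folded p_def]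
  have "x * p * y \<in> J" for x y
  proof -
    have "x * p * y = jordan_prod (p * y) x - p * (y * x)"
      by (simp add: jordan_prod_def mult.assoc)
    then show ?thesis
      using one_sided absorb by (simp add: subspace_diff[OF sub])
  qed
  then have "multiples UNIV p \<subseteq> J"
    using one_sided absorb ab by (auto simp: multiples_def p_def)
  then show ?thesis
    unfolding ideal_gen_def p_def[symmetric] using sub by (rule span_minimal)
qed

text \<open>
  Let \<open>\<circ>\<close> be the Jordan product. Both identities come from expanding \<open>c \<circ> c = 2 c c\<close> and
  \<open>c \<circ> (c \<circ> x) = c c x + 2 c x c + x c c\<close>, which are Jordan products of elements of \<open>J\<close>.
\<close>

lemma square_zero_sandwich_if_jordan_prod_zero:
  assumes J: "plus.two_sided_ideal J" and two: "(2::'k) \<noteq> 0" and c: "c \<in> J"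
    and zero: "\<And>a b. a \<in> J \<Longrightarrow> b \<in> J \<Longrightarrow> jordan_prod a b = 0"
  shows "c * c = 0" "c * x * c = 0"
proof -
  have half: "u = 0" if "u + u = 0" for u :: 'a
    using double_in_subspace_iff[OF subspace_single_0 two] that by simp
  show sq: "c * c = 0"
    using zero[OF c c] by (intro half[of "c * c"]) (simp add: jordan_prod_def)
  have sq_mult: "c * (c * x) = 0"
    by (simp add: mult.assoc[symmetric] sq)
  have "jordan_prod c x \<in> J"
    using J c by (auto simp: plus.two_sided_ideal_def)
  then have "jordan_prod c (jordan_prod c x) = 0"
    using zero c by simp
  then show "c * x * c = 0"
    by (intro half[of "c * x * c"]) (simp add: jordan_prod_def distrib_left distrib_right sq sq_mult mult.assoc)
qed

section \<open>Elements with \<open>c c = 0\<close> and \<open>c A c = 0\<close>\<close>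

text \<open>
  The ideal of \<open>c\<close> is annihilated by \<open>c\<close> on both sides, so in the products \<open>x c\<close>, \<open>c y\<close>, \<open>x c y\<close> that
  span it only the classes of \<open>x\<close> and \<open>y\<close> modulo the ideal matter.
\<close>

lemma square_zero_sandwich_ideal_gen_subset:
  assumes sq: "c * c = 0" and sandwich: "\<And>x. c * x * c = 0"
    and B: "span (B \<union> ideal_gen c) = UNIV"
  shows "ideal_gen c \<subseteq> span (multiples B c)"
proof -
  have "c * g = 0" "g * c = 0" if "g \<in> multiples UNIV c" for g
    using that sq sandwich unfolding multiples_def
    by (auto simp: mult.assoc) (simp_all add: mult.assoc[symmetric])
  then have annihilates: "c * v = 0" "v * c = 0" if "v \<in> ideal_gen c" for v
    using prod_span_right[OF that[unfolded ideal_gen_def] subspace_single_0, of c]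
      prod_span_left[OF that[unfolded ideal_gen_def] subspace_single_0, of c] by auto
  have in_span: "u \<in> span (B \<union> ideal_gen c)" for u
    using B by simp
  have left: "x * c \<in> span {b * c |b. b \<in> B}" for x
    by (rule prod_span_left[OF in_span])
      (use annihilates in \<open>auto intro: span_base span_zero\<close>)
  have right: "c * y \<in> span (multiples B c)" for y
    by (rule prod_span_right[OF in_span])
      (use annihilates in \<open>auto simp: multiples_def intro: span_base span_zero\<close>)
  have both: "x * c * y \<in> span (multiples B c)" for x y
  proof (rule prod_span_left[OF left])
    fix s
    assume "s \<in> {b * c |b. b \<in> B}"
    then obtain b where b: "b \<in> B" "s = b * c"
      by blast
    show "s * y \<in> span (multiples B c)"
    proof (rule prod_span_right[OF in_span])
      fix t
      assume "t \<in> B \<union> ideal_gen c"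
      then show "s * t \<in> span (multiples B c)"
        using b annihilates by (auto simp: multiples_def mult.assoc intro: span_base span_zero)
    qed simp
  qed simp
  have "x * c \<in> span (multiples B c)" for x
    using left[of x] span_mono[of "{b * c |b. b \<in> B}" "multiples B c"]
    by (auto simp: multiples_def)
  then have "multiples UNIV c \<subseteq> span (multiples B c)"
    using right both by (auto simp: multiples_def[of UNIV]) (auto simp: multiples_def intro: span_base)
  then show ?thesis
    unfolding ideal_gen_def by (rule span_minimal) simp
qed

lemma just_infinite_no_square_zero_sandwich:
  fixes c :: 'a
  assumes just_infinite: "just_infinite_algebra scale (*)"
    and c: "c * c = 0" "\<And>x. c * x * c = 0"
  shows "c = 0"
proof (rule ccontr)
  interpret just_infinite_algebra scale "(*)"
    by (rule just_infinite)
  assume "c \<noteq> 0"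
  then have "ideal_gen c \<noteq> {0}"
    using mem_ideal_gen by blast
  then have "finite_dim_quotient (ideal_gen c)"
    using finite_dim_quotients two_sided_ideal_ideal_gen by blast
  then obtain B where B: "finite B" "span (B \<union> ideal_gen c) = UNIV"
    by (auto simp: ideal_gen_def finite_dim_quotient_iff)
  have "ideal_gen c \<subseteq> span (multiples B c)"
    using c B(2) by (rule square_zero_sandwich_ideal_gen_subset)
  then have "B \<union> ideal_gen c \<subseteq> span (B \<union> multiples B c)"
    using span_superset[of "B \<union> multiples B c"]
      span_mono[of "multiples B c" "B \<union> multiples B c"] by blast
  then have "span (B \<union> ideal_gen c) \<subseteq> span (B \<union> multiples B c)"
    by (rule span_minimal) simp
  then have "span (B \<union> multiples B c) = UNIV"
    using B(2) by blast
  moreover have "finite (B \<union> multiples B c)"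
    using B(1) finite_multiples by simp
  ultimately have "finite_dim UNIV 0 (+) scale"
    by (auto simp: finite_dim_UNIV_iff)
  then show False
    using infinite_dim by contradiction
qed

end

section \<open>Just infinite Jordan algebras\<close>

theorem corollary1:
  fixes scale :: "'k::field \<Rightarrow> 'a::ring \<Rightarrow> 'a"
  assumes "assoc_algebra scale"
    and "just_infinite_algebra scale (*)"
    and "CHAR('k) \<noteq> 2"
  shows "just_infinite_algebra scale jordan_prod"
proof -
  interpret assoc_algebra scale
    by (rule assms(1))
  interpret A: just_infinite_algebra scale "(*)"
    by (rule assms(2))
  have two: "(2::'k) \<noteq> 0"
    using assms(3) by (rule two_neq_0_if_CHAR_neq_2)
  show ?thesis
  proof unfold_locales
    show "\<not> finite_dim UNIV 0 (+) scale"
      by (rule A.infinite_dim)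
  next
    fix J
    assume J: "plus.two_sided_ideal J" and "J \<noteq> {0}"
    then have sub: "subspace J"
      by (simp add: plus.two_sided_ideal_def)
    then obtain c where c: "c \<in> J" "c \<noteq> 0"
      using \<open>J \<noteq> {0}\<close> subspace_0 by blast
    have "\<exists>a\<in>J. \<exists>b\<in>J. jordan_prod a b \<noteq> 0"
    proof (rule ccontr)
      assume "\<not> ?thesis"
      then have "c * c = 0" "c * x * c = 0" for x
        using square_zero_sandwich_if_jordan_prod_zero[OF J two c(1)] by blast+
      then show False
        using just_infinite_no_square_zero_sandwich[OF assms(2)] c(2) by blast
    qed
    then obtain a b where ab: "a \<in> J" "b \<in> J" "jordan_prod a b \<noteq> 0"
      by blast
    then have "ideal_gen (jordan_prod a b) \<noteq> {0}"
      using mem_ideal_gen by blast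
    then have "finite_dim_quotient (ideal_gen (jordan_prod a b))"
      using A.finite_dim_quotients two_sided_ideal_ideal_gen by blast
    moreover have "subspace (ideal_gen (jordan_prod a b))"
      by (simp add: ideal_gen_def)
    ultimately show "finite_dim_quotient J"
      using finite_dim_quotient_mono sub jordan_prod_ideal_gen_subset[OF J two ab(1,2)] by blast
  qed
qed

end
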